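(* Let $X$ be a normed space and $\kappa$ an infinite cardinal. If $X$ has the 1-ASD2P$_{<\kappa}$, then $X^*$ fails the $(-1)$-BCP$_{<\kappa}$.
   Context: Normed spaces are real. $S_X$ is the unit sphere of $X$ and $X^*$ the topological dual. For a normed space $X$, $B\subset X$ and $A\subset X^*$, $B$ norms $A$ if for every $\lambda\in(0,1)$ and every $x^*\in A$ there is $x\in B\setminus\{0\}$ with $x^*(x)\ge\lambda\|x^*\|\|x\|$. For an infinite cardinal $\kappa$, $X$ has the 1-ASD2P$_{<\kappa}$ if for every set $A\subset S_{X^*}$ of cardinality strictly smaller than $\kappa$ there are $B\subset S_X$ and $x^*\in S_{X^*}$ such that $B$ norms $A$ and $x^*(x)=1$ for every $x\in B$. A normed space $Z$ fails the $(-1)$-BCP$_{<\kappa}$, for $\kappa$ uncountable, if for every subspace $Y\subset Z$ of density character strictly smaller than $\kappa$ there is $z\in S_Z$ such that $\|y+\lambda z\|\ge\|y\|+|\lambda|$ for every $y\in Y$ and $\lambda\in\mathbb R$. (For uncountable $\kappa$ this is equivalent to: for every $A\subset S_Z$ of cardinality strictly smaller than $\kappa$ there is $z\in S_Z$ with $\|x+z\|=2$ for all $x\in A$.) For $\kappa=\omega$ it means: for every finite $A\subset S_Z$ there is $z\in S_Z$ with $\|x+z\|=2$ for all $x\in A$. *)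

theory Defs
  imports "HOL-Analysis.Analysis"
begin

unbundle cardinal_syntax

text \<open>
  Cardinals are represented by cardinal orders \<open>\<kappa> :: 'k rel\<close> over an arbitrary type \<open>'k\<close>;
  the (heterogeneous) relations \<open><o\<close> and \<open>=o\<close> compare them, and \<open>|A|\<close> is the cardinality of \<open>A\<close>.
  A normed space is a type of class \<open>real_normed_vector\<close>, and its dual is
  \<open>'a \<Rightarrow>\<^sub>L real\<close> with the operator norm. The unit spheres are the sets \<open>sphere 0 1\<close>.
\<close>

definition norms :: "'a::real_normed_vector set \<Rightarrow> ('a \<Rightarrow>\<^sub>L real) set \<Rightarrow> bool" where
  "norms B A \<longleftrightarrow>
     (\<forall>t\<in>{0<..<1}. \<forall>f\<in>A. \<exists>x\<in>B - {0}. blinfun_apply f x \<ge> t * norm f * norm x)"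

definition one_ASD2P :: "'k rel \<Rightarrow> 'a::real_normed_vector itself \<Rightarrow> bool" where
  "one_ASD2P \<kappa> (_ :: 'a itself) \<longleftrightarrow>
     (\<forall>A :: ('a \<Rightarrow>\<^sub>L real) set. A \<subseteq> sphere 0 1 \<longrightarrow> |A| <o \<kappa> \<longrightarrow>
        (\<exists>B :: 'a set. \<exists>g :: 'a \<Rightarrow>\<^sub>L real. B \<subseteq> sphere 0 1 \<and> g \<in> sphere 0 1 \<and>
           norms B A \<and> (\<forall>x\<in>B. blinfun_apply g x = 1)))"

definition dense_subset :: "'a::topological_space set \<Rightarrow> 'a set \<Rightarrow> bool" where
  "dense_subset D S \<longleftrightarrow> D \<subseteq> S \<and> S \<subseteq> closure D"

text \<open>
  The density character is the least cardinality of a dense subset. The chosen representative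
  is unique up to \<open>=o\<close>; that the choice is never from an empty set is shown below.
\<close>

definition density_character :: "'a::topological_space set \<Rightarrow> 'a rel" where
  "density_character S =
     (SOME r. \<exists>D. dense_subset D S \<and> r = |D| \<and> (\<forall>D'. dense_subset D' S \<longrightarrow> |D| \<le>o |D'| ))"

lemma density_character_attained:
  "\<exists>D. dense_subset D S \<and> density_character S = |D| \<and> (\<forall>D'. dense_subset D' S \<longrightarrow> |D| \<le>o |D'| )"
proof -
  have ne: "card_of ` {D. dense_subset D S} \<noteq> {}"
    using closure_subset by (auto simp: dense_subset_def)
  have "\<forall>r\<in>card_of ` {D. dense_subset D S}. Card_order r"
    using card_of_Card_order by blast
  from exists_minim_Card_order[OF ne this]
  have "\<exists>r D. dense_subset D S \<and> r = |D| \<and> (\<forall>D'. dense_subset D' S \<longrightarrow> |D| \<le>o |D'| )"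
    by auto
  then show ?thesis
    unfolding density_character_def by (rule someI_ex)
qed

lemma density_character_less_iff:
  "density_character S <o \<kappa> \<longleftrightarrow> (\<exists>D. dense_subset D S \<and> |D| <o \<kappa>)"
  using density_character_attained[of S] ordLeq_ordLess_trans by metis

text \<open>
  The subspaces in the uncountable case are arbitrary linear subspaces, not necessarily closed.
  The notion is only meant for infinite \<open>\<kappa>\<close>, so the two cases below are exhaustive.
\<close>

definition fails_minus_one_BCP :: "'k rel \<Rightarrow> 'a::real_normed_vector itself \<Rightarrow> bool" where
  "fails_minus_one_BCP \<kappa> (_ :: 'a itself) \<longleftrightarrow>
     (natLeq <o \<kappa> \<longrightarrow>
        (\<forall>Y :: 'a set. subspace Y \<longrightarrow> density_character Y <o \<kappa> \<longrightarrow>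
           (\<exists>z\<in>sphere 0 1. \<forall>y\<in>Y. \<forall>t::real. norm (y + t *\<^sub>R z) \<ge> norm y + \<bar>t\<bar>))) \<and>
     (\<kappa> =o natLeq \<longrightarrow>
        (\<forall>A :: 'a set. A \<subseteq> sphere 0 1 \<longrightarrow> finite A \<longrightarrow>
           (\<exists>z\<in>sphere 0 1. \<forall>x\<in>A. norm (x + z) = 2)))"

end

theory Submission
  imports Defs
begin

text \<open>
  The witness for the conclusion is the functional \<open>g\<close> that the hypothesis provides. If \<open>B\<close> norms
  \<open>A\<close> and \<open>g\<close> is constantly \<open>1\<close> on \<open>B\<close>, then the points of \<open>B\<close> at which \<open>f \<in> A\<close> almost attains
  its norm are points at which \<open>g\<close> attains its own; evaluating \<open>s f + t g\<close> there shows that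
  the norm is additive on the nonnegative combinations of \<open>f\<close> and \<open>g\<close>
  (\<open>norm_add_of_norming_face\<close>).

  For finitely many functionals this is already the claim. For a subspace \<open>Y\<close> of small density
  character, let \<open>A\<close> consist of the normalized elements of a small dense subset \<open>D\<close> of \<open>Y\<close>; it
  is no larger than \<open>D\<close>. The inequality then holds on \<open>D\<close> for nonnegative scalars, passes to
  \<open>Y\<close> because it is a closed condition, and extends to negative scalars because \<open>Y = - Y\<close>.
\<close>

text \<open>
  All points of \<open>B\<close> lie in the face of the unit ball exposed by \<open>g\<close>, so a lower bound for \<open>f\<close> at
  such a point adds up with the value \<open>1\<close> of \<open>g\<close> without loss.
\<close>

lemma norm_add_of_norming_face:
  fixes f g :: "'a::real_normed_vector \<Rightarrow>\<^sub>L real"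
  assumes "norms B A" and "B \<subseteq> sphere 0 1" and g1: "\<And>x. x \<in> B \<Longrightarrow> blinfun_apply g x = 1"
    and "f \<in> A" and "s \<ge> 0"
  shows "norm (s *\<^sub>R f + t *\<^sub>R g) \<ge> s * norm f + t"
proof -
  have bound: "c * (s * norm f) \<le> norm (s *\<^sub>R f + t *\<^sub>R g) - t" if c: "0 < c" "c < 1" for c
  proof -
    obtain x where x: "x \<in> B" "blinfun_apply f x \<ge> c * norm f * norm x"
      using assms(1) \<open>f \<in> A\<close> c unfolding norms_def by fastforce
    have nx: "norm x = 1"
      using x(1) assms(2) by auto
    have "c * (s * norm f) + t \<le> s * blinfun_apply f x + t"
      using mult_left_mono[OF x(2) \<open>s \<ge> 0\<close>] nx by (simp add: algebra_simps)
    also have "\<dots> = blinfun_apply (s *\<^sub>R f + t *\<^sub>R g) x"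
      using g1[OF x(1)] by (simp add: blinfun.bilinear_simps)
    also have "\<dots> \<le> norm (s *\<^sub>R f + t *\<^sub>R g)"
      using norm_blinfun[of "s *\<^sub>R f + t *\<^sub>R g" x] nx by simp
    finally show ?thesis by simp
  qed
  have "s * norm f \<le> norm (s *\<^sub>R f + t *\<^sub>R g) - t"
    by (rule field_le_mult_one_interval) (rule bound)
  then show ?thesis by simp
qed

text \<open>
  For a fixed scalar the inequality is a closed condition on \<open>y\<close>, and the pairs \<open>(y, t)\<close> and
  \<open>(- y, - t)\<close> give it the same content; this is why a dense subset and nonnegative scalars suffice.
\<close>

lemma norm_add_on_subspace_of_dense:
  fixes z :: "'b::real_normed_vector"
  assumes "subspace Y" and "dense_subset D Y"
    and D: "\<And>d t. d \<in> D \<Longrightarrow> t \<ge> 0 \<Longrightarrow> norm (d + t *\<^sub>R z) \<ge> norm d + t"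
    and "y \<in> Y"
  shows "norm (y + t *\<^sub>R z) \<ge> norm y + \<bar>t\<bar>"
proof -
  have nonneg: "norm v + r \<le> norm (v + r *\<^sub>R z)" if "v \<in> Y" "r \<ge> 0" for v r
  proof -
    have "closed {v. norm v + r \<le> norm (v + r *\<^sub>R z)}"
      by (intro closed_Collect_le continuous_intros)
    then have "closure D \<subseteq> {v. norm v + r \<le> norm (v + r *\<^sub>R z)}"
      using D \<open>r \<ge> 0\<close> by (intro closure_minimal) auto
    then show ?thesis
      using assms(2) \<open>v \<in> Y\<close> unfolding dense_subset_def by auto
  qed
  show ?thesis
  proof (cases "t \<ge> 0")
    case True
    then show ?thesis using nonneg[OF \<open>y \<in> Y\<close>] by simp
  next
    case False
    have "- y \<in> Y"
      using assms(1,4) by (rule subspace_neg)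
    then have "norm (- y) + (- t) \<le> norm (- y + (- t) *\<^sub>R z)"
      using False by (intro nonneg) auto
    also have "- y + (- t) *\<^sub>R z = - (y + t *\<^sub>R z)"
      by simp
    finally show ?thesis using False by (simp only: norm_minus_cancel abs_of_neg not_le)
  qed
qed

theorem proposition3p6:
  fixes \<kappa> :: "'k rel"
  assumes "Card_order \<kappa>" and "cinfinite \<kappa>"
    and "one_ASD2P \<kappa> TYPE('a::real_normed_vector)"
  shows "fails_minus_one_BCP \<kappa> TYPE('a \<Rightarrow>\<^sub>L real)"
proof -
  have asd: "\<exists>B. \<exists>g :: 'a \<Rightarrow>\<^sub>L real. B \<subseteq> sphere 0 1 \<and> g \<in> sphere 0 1 \<and> norms B A \<and>
      (\<forall>x\<in>B. blinfun_apply g x = 1)"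
    if "A \<subseteq> sphere 0 1" "|A| <o \<kappa>" for A :: "('a \<Rightarrow>\<^sub>L real) set"
    using assms(3)[unfolded one_ASD2P_def, rule_format, OF that] .
  show ?thesis
    unfolding fails_minus_one_BCP_def
  proof (intro conjI impI allI)
    fix Y :: "('a \<Rightarrow>\<^sub>L real) set"
    assume Y: "subspace Y" and "density_character Y <o \<kappa>"
    then obtain D where D: "dense_subset D Y" "|D| <o \<kappa>"
      using density_character_less_iff by blast
    let ?A = "sgn ` (D - {0})"
    have "|?A| \<le>o |D|"
      using card_of_image card_of_mono1[of "D - {0}" D] ordLeq_transitive by blast
    then have "|?A| <o \<kappa>"
      using D(2) ordLeq_ordLess_trans by blast
    moreover have "?A \<subseteq> sphere 0 1"
      by (auto simp: norm_sgn split: if_splits)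
    ultimately obtain B and g :: "'a \<Rightarrow>\<^sub>L real" where Bg: "B \<subseteq> sphere 0 1" "g \<in> sphere 0 1" "norms B ?A"
      "\<And>x. x \<in> B \<Longrightarrow> blinfun_apply g x = 1"
      using asd[of ?A] by meson
    have "norm (d + t *\<^sub>R g) \<ge> norm d + t" if "d \<in> D" "t \<ge> 0" for d t
    proof (cases "d = 0")
      case True
      then show ?thesis using Bg(2) that by simp
    next
      case False
      then have "norm (norm d *\<^sub>R sgn d + t *\<^sub>R g) \<ge> norm d * norm (sgn d) + t"
        using \<open>d \<in> D\<close> by (intro norm_add_of_norming_face[OF Bg(3,1,4)]) auto
      then show ?thesis
        using False by (simp add: norm_sgn sgn_div_norm)
    qed
    then have "\<forall>y\<in>Y. \<forall>t. norm (y + t *\<^sub>R g) \<ge> norm y + \<bar>t\<bar>"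
      using norm_add_on_subspace_of_dense[OF Y D(1)] by blast
    then show "\<exists>z\<in>sphere 0 1. \<forall>y\<in>Y. \<forall>t. norm (y + t *\<^sub>R z) \<ge> norm y + \<bar>t\<bar>"
      using Bg(2) by blast
  next
    fix A :: "('a \<Rightarrow>\<^sub>L real) set"
    assume A: "A \<subseteq> sphere 0 1" and "finite A"
    then have "|A| <o \<kappa>"
      using finite_iff_ordLess_natLeq ordLess_ordLeq_trans
        natLeq_ordLeq_cinfinite[OF conjI[OF assms(2,1)]] by blast
    then obtain B and g :: "'a \<Rightarrow>\<^sub>L real" where Bg: "B \<subseteq> sphere 0 1" "g \<in> sphere 0 1" "norms B A"
      "\<And>x. x \<in> B \<Longrightarrow> blinfun_apply g x = 1"
      using asd[OF A] by meson
    have "norm (f + g) = 2" if "f \<in> A" for f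
    proof (rule antisym)
      have "norm f = 1" "norm g = 1"
        using A that Bg(2) by auto
      then show "norm (f + g) \<le> 2" "2 \<le> norm (f + g)"
        using norm_triangle_ineq[of f g]
          norm_add_of_norming_face[OF Bg(3,1,4) that, of 1 1] by simp_all
    qed
    then show "\<exists>z\<in>sphere 0 1. \<forall>x\<in>A. norm (x + z) = 2"
      using Bg(2) by blast
  qed
qed

end
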